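(* The set of all ordinary sets does not exist; that is, there is no set $H$ such that $H$ contains all ordinary sets and $H$ does not contain any extraordinary set.
   Context: A set is called ordinary if it is not a member of itself. A set is called extraordinary if it belongs to itself. *)

theory Defs
  imports Main
begin

(* HOL sets are typed, so "x is a member of x" cannot be stated with the library's
   set type.  The type variable 's is the universe of (untyped) sets and mem is its
   membership relation: "mem x y" reads "x is a member of y".  No set-theoretic axiom
   is imposed on mem. *)

definition ordinary :: "('s \<Rightarrow> 's \<Rightarrow> bool) \<Rightarrow> 's \<Rightarrow> bool" where
  "ordinary mem x \<longleftrightarrow> \<not> mem x x"

definition extraordinary :: "('s \<Rightarrow> 's \<Rightarrow> bool) \<Rightarrow> 's \<Rightarrow> bool" where
  "extraordinary mem x \<longleftrightarrow> mem x x"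

end

theory Submission
  imports Defs
begin

text \<open>
  This is Russell's argument. A set \<open>H\<close> of the excluded kind would have to be classified
  itself: if it were ordinary it would belong to itself, and if it were extraordinary it would
  not, so each of the two possibilities turns into its own negation. The contradiction comes from the
  instance \<open>x = H\<close> of the two conditions.
\<close>

theorem mainTheorem2:
  fixes mem :: "'s \<Rightarrow> 's \<Rightarrow> bool"
  shows "\<nexists>H. (\<forall>x. ordinary mem x \<longrightarrow> mem x H) \<and> (\<forall>x. extraordinary mem x \<longrightarrow> \<not> mem x H)"
  unfolding ordinary_def extraordinary_def by blast

end
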